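(* Let $1\le M<N$, and let $p_H$ be a probability distribution on $\mathbb{R}^N$ (the prior distribution of the CSI $\mathbf{H}$, regarded as a real vector). Let $f(\cdot;\theta):\mathbb{R}^N\to\mathbb{R}^M\times\mathbb{R}^{N-M}$ be an invertible neural network, written $f(\mathbf{H};\theta)=[\mathbf{z},\mathbf{r}]=[f_{\mathbf{z}}(\mathbf{H};\theta),f_{\mathbf{r}}(\mathbf{H};\theta)]$, with inverse $g(\cdot;\theta)=f^{-1}(\cdot;\theta)$. Let $q(\mathbf{z},\mathbf{r})$ be the joint distribution of $(f_{\mathbf{z}}(\mathbf{H};\theta),f_{\mathbf{r}}(\mathbf{H};\theta))$ when $\mathbf{H}\sim p_H$, let $p(\mathbf{z})$ be the marginal distribution of $f_{\mathbf{z}}(\mathbf{H};\theta)$, and let $p_R=\mathcal{N}(\mathbf{0},\mathbf{I})$ be the standard Gaussian distribution on $\mathbb{R}^{N-M}$. Suppose that $f$ is trained so that the loss $$\mathcal{L}_{\mathbf{r}}=\mathrm{MMD}^2\big(q(\mathbf{z},\mathbf{r}),\,p(\mathbf{z})\,p_R(\mathbf{r})\big)$$ equals zero, where $p(\mathbf{z})\,p_R(\mathbf{r})$ denotes the product distribution. Let $\mathbf{z}=f_{\mathbf{z}}(\mathbf{H};\theta)$ with $\mathbf{H}\sim p_H$, let $\mathbf{r}\sim p_R$ be sampled independently of $\mathbf{H}$, and let $\widehat{\mathbf{H}}=g(\mathbf{z},\mathbf{r};\theta)$ be the reconstructed sample. Then the marginal distribution $q(\mathbf{H})$ of $\widehat{\mathbf{H}}$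 matches the true distribution $p_H$, i.e. $$\mathrm{MMD}^2\big(q(\mathbf{H}),p_H(\mathbf{H})\big)=0 .$$
   Context: Invertible neural network (INN): a bijection $f(\cdot;\theta):\mathbb{R}^N\to\mathbb{R}^M\times\mathbb{R}^{N-M}$ with parameters $\theta$, obtained by composing finitely many invertible blocks (possibly with coordinate permutations between them, and preceded by a fixed invertible linear transformation of the input). The input of a block is split as $[\mathbf{H}_1^i,\mathbf{H}_2^i]\in\mathbb{R}^M\times\mathbb{R}^{N-M}$ and the block outputs $\mathbf{H}_1^{i+1}=\mathbf{H}_1^i+\phi(\mathbf{H}_2^i)$, $\mathbf{H}_2^{i+1}=\mathbf{H}_2^i\odot\exp[\rho(\mathbf{H}_1^{i+1})]+\eta(\mathbf{H}_1^{i+1})$, where $\odot$ and $\exp$ are elementwise and $\phi,\rho,\eta$ are arbitrary ordinary neural networks (continuous functions, not required to be invertible) of matching dimensions, which may differ from block to block. Thus $f$ and $g=f^{-1}$ are both continuous. Maximum mean discrepancy (MMD): for probability distributions $P,Q$ on the same Euclidean space and a kernel $K$ on that space, $\mathrm{MMD}^2(P,Q)=\mathbb{E}[K(X,X')]+\mathbb{E}[K(Y,Y')]-2\,\mathbb{E}[K(X,Y)]$, where $X,X'\sim P$ and $Y,Y'\sim Q$ are all independent. The base kernel is the inverse multiquadric kernel $k(\mathbf{x},\mathbf{y})=\frac{C}{C+\|\mathbf{x}-\mathbf{y}\|_2^2}$ with a constant $C>0$. For distributions of pairs $(\mathbf{z},\mathbf{r})\in\mathbb{R}^M\times\mathbb{R}^{N-M}$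 the kernel is $K((\mathbf{z},\mathbf{r}),(\mathbf{z}',\mathbf{r}'))=k(\mathbf{z},\mathbf{z}')\,k(\mathbf{r},\mathbf{r}')$; for distributions on $\mathbb{R}^N$ (distributions of $\mathbf{H}$) the kernel is $K=k$. *)

theory Defs
  imports "HOL-Probability.Probability"
begin

text \<open>
  Vectors in \<open>\<real>\<^sup>N\<close> are indexed by the sum type \<open>'m + 'r\<close>, where \<open>M = CARD('m)\<close> and
  \<open>N - M = CARD('r)\<close>; the \<open>Inl\<close> coordinates are the first \<open>M\<close> ones.  As types are nonempty,
  \<open>1 \<le> M < N\<close> holds automatically.
\<close>

definition split_vec :: "(real, 'm::finite + 'r::finite) vec \<Rightarrow> (real ^ 'm) \<times> (real ^ 'r)" where
  "split_vec x = ((\<chi> i. x $ Inl i), (\<chi> j. x $ Inr j))"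

definition join_vec :: "(real ^ 'm::finite) \<times> (real ^ 'r::finite) \<Rightarrow> (real, 'm + 'r) vec" where
  "join_vec p = (\<chi> k. case k of Inl i \<Rightarrow> fst p $ i | Inr j \<Rightarrow> snd p $ j)"

definition permute_coords :: "('n \<Rightarrow> 'n) \<Rightarrow> real ^ 'n::finite \<Rightarrow> real ^ 'n" where
  "permute_coords \<pi> x = (\<chi> k. x $ \<pi> k)"

definition coupling_block ::
  "(real ^ 'r \<Rightarrow> real ^ 'm) \<Rightarrow> (real ^ 'm \<Rightarrow> real ^ 'r) \<Rightarrow> (real ^ 'm \<Rightarrow> real ^ 'r) \<Rightarrow>
    (real ^ 'm::finite) \<times> (real ^ 'r::finite) \<Rightarrow> (real ^ 'm) \<times> (real ^ 'r)" where
  "coupling_block \<phi> \<rho> \<eta> h =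
    (let h1 = fst h + \<phi> (snd h)
     in (h1, (\<chi> j. snd h $ j * exp (\<rho> h1 $ j)) + \<eta> h1))"

text \<open>
  The subnetworks \<open>\<phi>\<close>, \<open>\<rho>\<close>, \<open>\<eta>\<close> are arbitrary continuous functions and may differ from block to
  block.  The identity is admitted both as preprocessing map \<open>L\<close> and as permutation \<open>\<pi>\<close>, so
  both are optional; a permutation before the first block could also be absorbed in \<open>L\<close>.
\<close>

inductive invertible_nn ::
  "((real, 'm::finite + 'r::finite) vec \<Rightarrow> (real ^ 'm) \<times> (real ^ 'r)) \<Rightarrow> bool" where
  preprocess: "linear L \<Longrightarrow> bij L \<Longrightarrow> invertible_nn (split_vec \<circ> L)"
| block: "invertible_nn f \<Longrightarrow> bij \<pi> \<Longrightarrow>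
    continuous_on UNIV \<phi> \<Longrightarrow> continuous_on UNIV \<rho> \<Longrightarrow> continuous_on UNIV \<eta> \<Longrightarrow>
    invertible_nn (coupling_block \<phi> \<rho> \<eta> \<circ> split_vec \<circ> permute_coords \<pi> \<circ> join_vec \<circ> f)"

lemma bij_split_vec: "bij split_vec"
  by (rule bij_betw_byWitness[where f' = join_vec])
     (auto simp: split_vec_def join_vec_def vec_eq_iff split: sum.split)

lemma bij_join_vec: "bij join_vec"
  by (rule bij_betw_byWitness[where f' = split_vec])
     (auto simp: split_vec_def join_vec_def vec_eq_iff split: sum.split)

lemma bij_permute_coords: "bij \<pi> \<Longrightarrow> bij (permute_coords \<pi>)"
  by (rule bij_betw_byWitness[where f' = "permute_coords (inv \<pi>)"])
     (auto simp: permute_coords_def vec_eq_iff bij_is_inj bij_is_surj surj_f_inv_f)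

lemma bij_coupling_block: "bij (coupling_block \<phi> \<rho> \<eta>)"
  by (rule bij_betw_byWitness[where
        f' = "\<lambda>(h1, h2). let k = (\<chi> j. (h2 $ j - \<eta> h1 $ j) / exp (\<rho> h1 $ j)) in (h1 - \<phi> k, k)"])
     (auto simp: coupling_block_def vec_eq_iff Let_def)

lemma invertible_nn_bij: "invertible_nn f \<Longrightarrow> bij f"
  by (induction rule: invertible_nn.induct)
     (intro bij_comp bij_split_vec bij_join_vec bij_permute_coords bij_coupling_block | assumption)+

definition imq_kernel :: "real \<Rightarrow> 'a::real_normed_vector \<Rightarrow> 'a \<Rightarrow> real" where
  "imq_kernel C x y = C / (C + (norm (x - y))\<^sup>2)"

definition pair_kernel ::
  "('a \<Rightarrow> 'a \<Rightarrow> real) \<Rightarrow> ('b \<Rightarrow> 'b \<Rightarrow> real) \<Rightarrow> 'a \<times> 'b \<Rightarrow> 'a \<times> 'b \<Rightarrow> real" where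
  "pair_kernel k l p q = k (fst p) (fst q) * l (snd p) (snd q)"

text \<open>Expectations over independent samples are integrals over product measures.\<close>

definition MMD2 :: "('a \<Rightarrow> 'a \<Rightarrow> real) \<Rightarrow> 'a measure \<Rightarrow> 'a measure \<Rightarrow> real" where
  "MMD2 K P Q =
    (LINT w|(P \<Otimes>\<^sub>M P). K (fst w) (snd w)) + (LINT w|(Q \<Otimes>\<^sub>M Q). K (fst w) (snd w))
      - 2 * (LINT w|(P \<Otimes>\<^sub>M Q). K (fst w) (snd w))"

definition std_gaussian :: "(real ^ 'r::finite) measure" where
  "std_gaussian = density lborel (\<lambda>x. ennreal (\<Prod>j\<in>UNIV. std_normal_density (x $ j)))"

end

theory Submission
  imports Defs
begin

text \<open>
  The inverse multiquadric kernel is a mixture of Gaussian kernels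
  \<open>exp (- s * (norm (x - y))\<^sup>2)\<close> with an exponentially distributed parameter \<open>s\<close>, and a Gaussian
  kernel is the \<open>L\<^sup>2\<close> inner product of two narrower Gaussians.  Hence the product kernel has a
  nonnegative feature representation \<open>K x y = (\<integral>\<omega>. \<psi> x \<omega> * \<psi> y \<omega>)\<close>, and by Fubini the squared MMD
  is \<open>\<integral>\<omega>. ((\<integral>x. \<psi> x \<omega> \<partial>P) - (\<integral>x. \<psi> x \<omega> \<partial>Q))\<^sup>2\<close>.  If it vanishes, all Gaussian smoothings of
  \<open>P\<close> and \<open>Q\<close> agree, first almost everywhere and then everywhere by continuity; letting the
  bandwidth tend to zero gives \<open>P = Q\<close>.  So the zero loss makes \<open>(z, r)\<close> distributed exactly as
  \<open>f H\<close>, and pushing forward along the continuous map \<open>inv f\<close> returns \<open>p_H\<close>.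
\<close>

section \<open>Feature representation of the inverse multiquadric kernel\<close>

lemma imq_kernel_pos: "C > 0 \<Longrightarrow> imq_kernel C x y > 0"
  unfolding imq_kernel_def by (intro divide_pos_pos add_pos_nonneg) auto

lemma imq_kernel_le_1: "C > 0 \<Longrightarrow> imq_kernel C x y \<le> 1"
  unfolding imq_kernel_def by (subst divide_le_eq_1_pos) (auto intro: add_pos_nonneg)

text \<open>The integrand is a constant multiple of the normal density with mean \<open>m\<close>
  and variance \<open>1 / (2 * s)\<close>, whose total mass is one.\<close>

lemma nn_integral_gaussian_real:
  fixes m s :: real
  assumes "s > 0"
  shows "(\<integral>\<^sup>+x. ennreal (exp (-(s * (x - m)\<^sup>2))) \<partial>lborel) = ennreal (sqrt (pi / s))"
proof -
  let ?\<sigma> = "1 / sqrt (2 * s)"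
  interpret prob_space "density lborel (normal_density m ?\<sigma>)"
    using assms by (intro prob_space_normal_density) simp
  have "(\<integral>\<^sup>+x. ennreal (normal_density m ?\<sigma> x) \<partial>lborel) = 1"
    using emeasure_space_1 by (simp add: emeasure_density)
  moreover have "exp (-(s * (x - m)\<^sup>2)) = sqrt (pi / s) * normal_density m ?\<sigma> x" for x
    using assms by (simp add: normal_density_def power_divide real_sqrt_divide field_simps)
  ultimately show ?thesis
    using assms by (simp add: ennreal_mult nn_integral_cmult)
qed

text \<open>The squared distance is a sum over an orthonormal basis, so the Gaussian factorises into
  one-dimensional ones.\<close>

lemma nn_integral_gaussian:
  fixes m :: "'a::euclidean_space"
  assumes "s > 0"
  shows "(\<integral>\<^sup>+x. ennreal (exp (-(s * (norm (x - m))\<^sup>2))) \<partial>lborel) = ennreal (sqrt (pi / s) ^ DIM('a))"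
proof -
  have "ennreal (exp (-(s * (norm (x - m))\<^sup>2))) =
      (\<Prod>b\<in>Basis. ennreal (exp (-(s * (x \<bullet> b - m \<bullet> b)\<^sup>2))))" for x
  proof -
    have "(norm (x - m))\<^sup>2 = (\<Sum>b\<in>Basis. (x \<bullet> b - m \<bullet> b)\<^sup>2)"
      unfolding power2_norm_eq_inner by (subst euclidean_inner) (simp add: inner_diff_left power2_eq_square)
    then show ?thesis
      by (simp add: prod_ennreal sum_distrib_left sum_negf flip: exp_sum)
  qed
  then have "(\<integral>\<^sup>+x. ennreal (exp (-(s * (norm (x - m))\<^sup>2))) \<partial>lborel) =
      (\<integral>\<^sup>+x. (\<Prod>b\<in>Basis. ennreal (exp (-(s * (x \<bullet> b - m \<bullet> b)\<^sup>2)))) \<partial>lborel)"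
    by simp
  also have "\<dots> = (\<Prod>b\<in>(Basis::'a set). ennreal (sqrt (pi / s)))"
    by (subst nn_integral_lborel_prod) (auto simp: nn_integral_gaussian_real[OF assms])
  finally show ?thesis
    using assms by (simp add: ennreal_power)
qed

text \<open>
  The point \<open>p = (s, w)\<close> consists of the mixing parameter and the centre of a Gaussian.  The factor
  \<open>C * exp (- s * C)\<close> is the mixing density of the kernel, and \<open>sqrt (4 * s / pi) ^ DIM('a)\<close>
  normalises the Gaussian in \<open>w\<close> that remains after completing the square.
\<close>

definition imq_feature :: "real \<Rightarrow> 'a::euclidean_space \<Rightarrow> real \<times> 'a \<Rightarrow> real" where
  "imq_feature C x p = (if fst p > 0
     then sqrt (C * exp (-(fst p * C)) * sqrt (4 * fst p / pi) ^ DIM('a))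
        * exp (-(2 * fst p * (norm (x - snd p))\<^sup>2))
     else 0)"

lemma borel_measurable_imq_feature [measurable (raw)]:
  assumes [measurable]: "f \<in> borel_measurable M" "g \<in> borel_measurable M"
  shows "(\<lambda>z. imq_feature C (f z) (g z)) \<in> borel_measurable M"
proof -
  have [measurable]: "(\<lambda>z. fst (g z)) \<in> borel_measurable M" "(\<lambda>z. snd (g z)) \<in> borel_measurable M"
    using assms(2) unfolding borel_prod[symmetric] by measurable
  show ?thesis unfolding imq_feature_def by measurable
qed

lemma imq_feature_nonneg: "C > 0 \<Longrightarrow> imq_feature C x p \<ge> 0"
  unfolding imq_feature_def by simp

text \<open>Completing the square in \<open>w\<close>: the product of the Gaussians about
  \<open>x\<close> and \<open>y\<close> becomes a Gaussian in \<open>w\<close> about their midpoint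
  times a factor depending only on \<open>x - y\<close>.\<close>

lemma norm_midpoint_identity:
  fixes x y w :: "'a::real_inner"
  shows "2 * (norm (x - w))\<^sup>2 + 2 * (norm (y - w))\<^sup>2 =
    (norm (x - y))\<^sup>2 + 4 * (norm (w - (1/2) *\<^sub>R (x + y)))\<^sup>2"
  by (simp add: power2_norm_eq_inner inner_commute algebra_simps)

text \<open>Integrating over the centre first leaves \<open>C * exp (-(s * d))\<close> with
  \<open>d = C + (norm (x - y))\<^sup>2\<close>. This is \<open>C / d\<close> times the exponential
  density of rate \<open>d\<close>, so integrating over \<open>s\<close> gives
  \<open>C / d\<close>.\<close>

lemma nn_integral_imq_feature:
  fixes x y :: "'a::euclidean_space"
  assumes "C > 0"
  shows "(\<integral>\<^sup>+p. ennreal (imq_feature C x p * imq_feature C y p) \<partial>lborel) = ennreal (imq_kernel C x y)"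
proof -
  let ?d = "C + (norm (x - y))\<^sup>2"
  have d: "?d > 0" using assms by (intro add_pos_nonneg) auto
  \<comment> \<open>At \<open>s = 0\<close> the feature is 0 by definition while the exponential
    density is \<open>?d\<close>, so this single point, a null set, is excluded. For negative
    \<open>s\<close> both sides vanish.\<close>
  have inner: "(\<integral>\<^sup>+w. ennreal (imq_feature C x (s, w) * imq_feature C y (s, w)) \<partial>lborel)
      = ennreal (C / ?d) * ennreal (exponential_density ?d s)" if "s \<noteq> 0" for s
  proof (cases "s > 0")
    case True
    have "imq_feature C x (s, w) * imq_feature C y (s, w) =
        C * exp (-(s * ?d)) * sqrt (4 * s / pi) ^ DIM('a) *
          exp (-(4 * s * (norm (w - (1/2) *\<^sub>R (x + y)))\<^sup>2))" for w
    proof -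
      have "exp (-(2 * s * (norm (x - w))\<^sup>2)) * exp (-(2 * s * (norm (y - w))\<^sup>2)) =
         exp (-(s * (2 * (norm (x - w))\<^sup>2 + 2 * (norm (y - w))\<^sup>2)))"
        by (simp add: mult_exp_exp algebra_simps)
      also have "\<dots> = exp (-(s * (norm (x - y))\<^sup>2)) * exp (-(4 * s * (norm (w - (1/2) *\<^sub>R (x + y)))\<^sup>2))"
        unfolding norm_midpoint_identity by (simp add: mult_exp_exp algebra_simps)
      finally have *: "exp (-(2 * s * (norm (x - w))\<^sup>2)) * exp (-(2 * s * (norm (y - w))\<^sup>2)) = \<dots>" .
      \<comment> \<open>Each feature carries the square root of the weight, so a product of two
        features carries the weight itself.\<close>
      have r: "sqrt a * e * (sqrt a * e') = a * (e * e')" if "a \<ge> 0" for a e e' :: real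
        using that by (simp add: algebra_simps)
      have "imq_feature C x (s, w) * imq_feature C y (s, w) =
          C * exp (-(s * C)) * sqrt (4 * s / pi) ^ DIM('a) *
          (exp (-(2 * s * (norm (x - w))\<^sup>2)) * exp (-(2 * s * (norm (y - w))\<^sup>2)))"
        unfolding imq_feature_def using True assms by (simp del: real_sqrt_mult add: r)
      moreover have "exp (-(s * ?d)) = exp (-(s * C)) * exp (-(s * (norm (x - y))\<^sup>2))"
        by (simp add: mult_exp_exp algebra_simps)
      ultimately show ?thesis unfolding * by (simp only: mult_ac)
    qed
    then have "(\<integral>\<^sup>+w. ennreal (imq_feature C x (s, w) * imq_feature C y (s, w)) \<partial>lborel) =
        ennreal (C * exp (-(s * ?d)) * sqrt (4 * s / pi) ^ DIM('a)) * ennreal (sqrt (pi / (4 * s)) ^ DIM('a))"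
      using True assms
      by (simp add: ennreal_mult nn_integral_cmult nn_integral_gaussian del: real_sqrt_mult)
    also have "\<dots> = ennreal (C * exp (-(s * ?d)) * (sqrt (4 * s / pi) * sqrt (pi / (4 * s))) ^ DIM('a))"
      using True assms by (simp add: power_mult_distrib mult.assoc flip: ennreal_mult del: real_sqrt_mult)
    also have "sqrt (4 * s / pi) * sqrt (pi / (4 * s)) = 1"
      using True by (simp flip: real_sqrt_mult)
    finally have "(\<integral>\<^sup>+w. ennreal (imq_feature C x (s, w) * imq_feature C y (s, w)) \<partial>lborel) =
        ennreal (C * exp (-(s * ?d)))"
      by simp
    also have "C * exp (-(s * ?d)) = C / ?d * exponential_density ?d s"
      using True d by (simp add: exponential_density_def)
    also have "ennreal (C / ?d * exponential_density ?d s) = ennreal (C / ?d) * ennreal (exponential_density ?d s)"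
      using d assms by (intro ennreal_mult) (auto simp: exponential_density_def)
    finally show ?thesis .
  next
    case False
    then show ?thesis using that by (simp add: imq_feature_def exponential_density_def)
  qed
  interpret prob_space "density lborel (exponential_density ?d)"
    by (rule prob_space_exponential_density[OF d])
  have e1: "(\<integral>\<^sup>+s. ennreal (exponential_density ?d s) \<partial>lborel) = 1"
    using emeasure_space_1 by (simp add: emeasure_density)
  have "(\<integral>\<^sup>+p. ennreal (imq_feature C x p * imq_feature C y p) \<partial>lborel) =
      (\<integral>\<^sup>+s. \<integral>\<^sup>+w. ennreal (imq_feature C x (s, w) * imq_feature C y (s, w)) \<partial>lborel \<partial>lborel)"
    by (subst lborel_prod[symmetric], subst lborel.nn_integral_fst[symmetric])
      (auto simp: lborel_prod)
  also have "\<dots> = (\<integral>\<^sup>+s. ennreal (C / ?d) * ennreal (exponential_density ?d s) \<partial>lborel)"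
    using AE_lborel_singleton[of "0::real"] by (intro nn_integral_cong_AE) (auto elim!: eventually_mono simp: inner)
  also have "\<dots> = ennreal (C / ?d)"
    by (simp add: nn_integral_cmult e1)
  finally show ?thesis by (simp add: imq_kernel_def)
qed


section \<open>Zero discrepancy and equality of feature means\<close>

text \<open>As the features are nonnegative, the integrals may be exchanged freely. The envelope
  \<open>W\<close> makes each feature integrable for fixed \<open>\<omega>\<close>, and the bound
  \<open>B\<close> makes the kernel expectations finite.\<close>

lemma MMD2_eq_0_imp_features_AE_eq:
  fixes \<psi> :: "'a \<Rightarrow> 'b \<Rightarrow> real"
  assumes "prob_space P" "prob_space Q" and sets: "sets P = sets N" "sets Q = sets N"
    and "sigma_finite_measure \<mu>"
    and \<psi>_meas [measurable]: "(\<lambda>q. \<psi> (fst q) (snd q)) \<in> borel_measurable (N \<Otimes>\<^sub>M \<mu>)"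
    and K_meas [measurable]: "(\<lambda>q. K (fst q) (snd q)) \<in> borel_measurable (N \<Otimes>\<^sub>M N)"
    and \<psi>: "\<And>x \<omega>. 0 \<le> \<psi> x \<omega>" "\<And>x \<omega>. \<psi> x \<omega> \<le> W \<omega>"
    and K: "\<And>x y. 0 \<le> K x y" "\<And>x y. K x y \<le> B"
    and feature: "\<And>x y. (\<integral>\<^sup>+\<omega>. ennreal (\<psi> x \<omega> * \<psi> y \<omega>) \<partial>\<mu>) = ennreal (K x y)"
    and MMD: "MMD2 K P Q = 0"
  shows "AE \<omega> in \<mu>. (\<integral>x. \<psi> x \<omega> \<partial>P) = (\<integral>x. \<psi> x \<omega> \<partial>Q)"
proof -
  interpret \<mu>: sigma_finite_measure \<mu> by fact
  have [measurable (raw)]: "(\<lambda>z. \<psi> (a z) (b z)) \<in> borel_measurable X"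
    if "a \<in> measurable X N" "b \<in> measurable X \<mu>" for X :: "'c measure" and a b
    using measurable_compose[OF measurable_Pair[OF that] \<psi>_meas] by simp
  have mean_meas: "(\<lambda>\<omega>. \<integral>x. \<psi> x \<omega> \<partial>D) \<in> borel_measurable \<mu>"
    if "prob_space D" "sets D = sets N" for D
  proof -
    interpret prob_space D by fact
    note [measurable_cong] = that(2)
    have [measurable]: "(\<lambda>q. \<psi> (snd q) (fst q)) \<in> borel_measurable (\<mu> \<Otimes>\<^sub>M N)"
      using measurable_compose[OF measurable_pair_swap' \<psi>_meas] by (simp add: case_prod_beta)
    show ?thesis by measurable
  qed
  have mean_nonneg: "0 \<le> (\<integral>x. \<psi> x \<omega> \<partial>D)" for D \<omega>
    using \<psi> by simp
  \<comment> \<open>Stated for arbitrary \<open>D\<close> and \<open>E\<close>, since it is needed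
    for the pairs \<open>(P, P)\<close>, \<open>(Q, Q)\<close> and \<open>(P, Q)\<close>. Moving the
    integral over \<open>\<omega>\<close> innermost turns the product of features into
    \<open>K\<close>.\<close>
  have cross: "(\<integral>\<^sup>+\<omega>. ennreal ((\<integral>x. \<psi> x \<omega> \<partial>D) * (\<integral>y. \<psi> y \<omega> \<partial>E)) \<partial>\<mu>)
      = ennreal (LINT w|(D \<Otimes>\<^sub>M E). K (fst w) (snd w))"
    if "prob_space D" "sets D = sets N" "prob_space E" "sets E = sets N" for D E
  proof -
    interpret D: prob_space D by fact
    interpret E: prob_space E by fact
    interpret DE: pair_prob_space D E ..
    interpret D\<mu>: pair_sigma_finite D \<mu> ..
    interpret E\<mu>: pair_sigma_finite E \<mu> ..
    note [measurable_cong] = that(2,4)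
    have mean: "ennreal (\<integral>x. \<psi> x \<omega> \<partial>G) = (\<integral>\<^sup>+x. ennreal (\<psi> x \<omega>) \<partial>G)"
      if "\<omega> \<in> space \<mu>" "prob_space G" "sets G = sets N" for G \<omega>
    proof -
      interpret G: prob_space G by fact
      note [measurable_cong] = that(3)
      have [measurable]: "(\<lambda>x. \<psi> x \<omega>) \<in> borel_measurable G"
        using measurable_compose[OF measurable_Pair2'[OF that(1)] \<psi>_meas]
        by (simp add: measurable_cong_sets[OF that(3) refl])
      have "integrable G (\<lambda>x. \<psi> x \<omega>)"
        by (rule G.integrable_const_bound[where B = "W \<omega>"]) (use \<psi> in auto)
      then show ?thesis
        using \<psi> by (subst nn_integral_eq_integral) auto
    qed
    have "(\<integral>\<^sup>+\<omega>. ennreal ((\<integral>x. \<psi> x \<omega> \<partial>D) * (\<integral>y. \<psi> y \<omega> \<partial>E)) \<partial>\<mu>)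
        = (\<integral>\<^sup>+\<omega>. (\<integral>\<^sup>+x. (\<integral>\<^sup>+y. ennreal (\<psi> x \<omega> * \<psi> y \<omega>) \<partial>E) \<partial>D) \<partial>\<mu>)"
    proof (rule nn_integral_cong)
      fix \<omega> assume \<omega>: "\<omega> \<in> space \<mu>"
      have [measurable]: "(\<lambda>x. \<psi> x \<omega>) \<in> borel_measurable N"
        using measurable_compose[OF measurable_Pair2'[OF \<omega>] \<psi>_meas] by simp
      have "ennreal ((\<integral>x. \<psi> x \<omega> \<partial>D) * (\<integral>y. \<psi> y \<omega> \<partial>E)) =
          (\<integral>\<^sup>+x. ennreal (\<psi> x \<omega>) \<partial>D) * (\<integral>\<^sup>+y. ennreal (\<psi> y \<omega>) \<partial>E)"
        using mean_nonneg \<omega> that by (simp add: ennreal_mult mean)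
      then show "ennreal ((\<integral>x. \<psi> x \<omega> \<partial>D) * (\<integral>y. \<psi> y \<omega> \<partial>E)) =
          (\<integral>\<^sup>+x. (\<integral>\<^sup>+y. ennreal (\<psi> x \<omega> * \<psi> y \<omega>) \<partial>E) \<partial>D)"
        using \<psi> by (simp add: ennreal_mult nn_integral_cmult nn_integral_multc)
    qed
    also have "\<dots> = (\<integral>\<^sup>+x. (\<integral>\<^sup>+\<omega>. (\<integral>\<^sup>+y. ennreal (\<psi> x \<omega> * \<psi> y \<omega>) \<partial>E) \<partial>\<mu>) \<partial>D)"
      by (rule D\<mu>.Fubini') measurable
    also have "\<dots> = (\<integral>\<^sup>+x. (\<integral>\<^sup>+y. (\<integral>\<^sup>+\<omega>. ennreal (\<psi> x \<omega> * \<psi> y \<omega>) \<partial>\<mu>) \<partial>E) \<partial>D)"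
    proof (rule nn_integral_cong)
      fix x assume "x \<in> space D"
      then have [measurable]: "x \<in> space N"
        using sets_eq_imp_space_eq[OF that(2)] by simp
      show "(\<integral>\<^sup>+\<omega>. (\<integral>\<^sup>+y. ennreal (\<psi> x \<omega> * \<psi> y \<omega>) \<partial>E) \<partial>\<mu>) =
          (\<integral>\<^sup>+y. (\<integral>\<^sup>+\<omega>. ennreal (\<psi> x \<omega> * \<psi> y \<omega>) \<partial>\<mu>) \<partial>E)"
        by (rule E\<mu>.Fubini') measurable
    qed
    also have "\<dots> = (\<integral>\<^sup>+w. ennreal (K (fst w) (snd w)) \<partial>(D \<Otimes>\<^sub>M E))"
      unfolding feature by (subst E.nn_integral_fst[symmetric]) auto
    also have "\<dots> = ennreal (LINT w|(D \<Otimes>\<^sub>M E). K (fst w) (snd w))"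
      using K by (intro nn_integral_eq_integral DE.P.integrable_const_bound[where B = B]) auto
    finally show ?thesis .
  qed
  let ?u = "\<lambda>\<omega>. \<integral>x. \<psi> x \<omega> \<partial>P" and ?v = "\<lambda>\<omega>. \<integral>x. \<psi> x \<omega> \<partial>Q"
  note [measurable] = mean_meas[OF assms(1) sets(1)] mean_meas[OF assms(2) sets(2)]
  have LINT_nonneg: "0 \<le> (LINT w|M. K (fst w) (snd w))" for M
    using K by simp
  \<comment> \<open>The nonnegative integrals in \<open>cross\<close> have finite values, so the
    products of means are Bochner integrable and the terms of \<open>MMD2\<close> can be subtracted
    under one integral.\<close>
  have bochner: "has_bochner_integral \<mu> (\<lambda>\<omega>. (\<integral>x. \<psi> x \<omega> \<partial>D) * (\<integral>y. \<psi> y \<omega> \<partial>E))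
      (LINT w|(D \<Otimes>\<^sub>M E). K (fst w) (snd w))"
    if "prob_space D" "sets D = sets N" "prob_space E" "sets E = sets N" for D E
    using mean_meas[of D] mean_meas[of E] that cross[of D E] mean_nonneg LINT_nonneg
    by (intro has_bochner_integral_nn_integral) auto
  have "has_bochner_integral \<mu> (\<lambda>\<omega>. ?u \<omega> * ?u \<omega> + ?v \<omega> * ?v \<omega> - 2 * (?u \<omega> * ?v \<omega>)) (MMD2 K P Q)"
    unfolding MMD2_def
    by (intro has_bochner_integral_add has_bochner_integral_diff has_bochner_integral_mult_right
        bochner sets assms(1,2))
  moreover have "(\<lambda>\<omega>. ?u \<omega> * ?u \<omega> + ?v \<omega> * ?v \<omega> - 2 * (?u \<omega> * ?v \<omega>)) = (\<lambda>\<omega>. (?u \<omega> - ?v \<omega>)\<^sup>2)"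
    by (simp add: power2_eq_square algebra_simps fun_eq_iff)
  ultimately have "has_bochner_integral \<mu> (\<lambda>\<omega>. (?u \<omega> - ?v \<omega>)\<^sup>2) 0"
    using MMD by simp
  then have "AE \<omega> in \<mu>. (?u \<omega> - ?v \<omega>)\<^sup>2 = 0"
    by (subst integral_nonneg_eq_0_iff_AE[symmetric])
      (auto simp: has_bochner_integral_iff)
  then show ?thesis by simp
qed

section \<open>Measures determined by their Gaussian smoothings\<close>

text \<open>The part of \<open>S\<close> where \<open>h\<close> is nonzero is open and Lebesgue
  null, and a nonempty open set is never null.\<close>

lemma continuous_on_AE_lborel_eq_0:
  fixes h :: "'a::euclidean_space \<Rightarrow> real"
  assumes "open S" "continuous_on S h" "AE x in lborel. x \<in> S \<longrightarrow> h x = 0" "x \<in> S"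
  shows "h x = 0"
proof -
  let ?U = "S \<inter> h -` (- {0})"
  have op: "open ?U"
    using assms by (intro continuous_open_preimage) auto
  then have "?U \<in> null_sets lborel"
    using assms(3) by (subst AE_iff_null_sets) (auto elim: eventually_mono)
  then have "negligible ?U"
    by (simp add: negligible_iff_null_sets null_sets_completionI)
  then have "?U = {}" using op open_not_negligible by blast
  then show ?thesis using assms(4) by auto
qed

text \<open>On a finite measure space the constant \<open>B\<close> is an integrable majorant, so
  dominated convergence along sequences applies.\<close>

lemma continuous_on_integral_of_bounded:
  fixes g :: "'a \<Rightarrow> 'b::metric_space \<Rightarrow> real"
  assumes "finite_measure M"
    and meas: "\<And>\<omega>. \<omega> \<in> S \<Longrightarrow> (\<lambda>x. g x \<omega>) \<in> borel_measurable M"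
    and bound: "\<And>x \<omega>. \<omega> \<in> S \<Longrightarrow> \<bar>g x \<omega>\<bar> \<le> B"
    and cont: "\<And>x. continuous_on S (g x)"
  shows "continuous_on S (\<lambda>\<omega>. \<integral>x. g x \<omega> \<partial>M)"
proof -
  interpret finite_measure M by fact
  show ?thesis
    unfolding continuous_on_sequentially comp_def
  proof (intro allI ballI impI, elim conjE)
    fix X a assume a: "a \<in> S" and X: "\<forall>n. X n \<in> S" "X \<longlonglongrightarrow> a"
    show "(\<lambda>n. \<integral>x. g x (X n) \<partial>M) \<longlonglongrightarrow> (\<integral>x. g x a \<partial>M)"
    proof (rule integral_dominated_convergence[where w = "\<lambda>_. B"])
      show "AE x in M. (\<lambda>n. g x (X n)) \<longlonglongrightarrow> g x a"
        using cont a X unfolding continuous_on_sequentially comp_def by blast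
    qed (use meas bound a X in auto)
  qed
qed

text \<open>Substitution \<open>w = x + c *\<^sub>R y\<close> with Jacobian
  \<open>c ^ DIM('a)\<close>. It moves \<open>x\<close> and \<open>c\<close> from the Gaussian into
  the argument of \<open>F\<close>.\<close>

lemma nn_integral_gaussian_dilate:
  fixes x :: "'a::euclidean_space" and c :: real
  assumes [measurable]: "F \<in> borel_measurable borel" and c: "c > 0"
  shows "(\<integral>\<^sup>+w. F w * ennreal (exp (-((1 / c)\<^sup>2 * (norm (x - w))\<^sup>2))) \<partial>lborel) =
    ennreal (c ^ DIM('a)) * (\<integral>\<^sup>+y. F (x + c *\<^sub>R y) * ennreal (exp (-((norm y)\<^sup>2))) \<partial>lborel)"
proof -
  have "exp (-((1 / c)\<^sup>2 * (norm (x - (x + c *\<^sub>R y)))\<^sup>2)) = exp (-((norm y)\<^sup>2))" for y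
    using c by (simp add: power_mult_distrib power_divide)
  then show ?thesis
    using c
    by (subst lborel_affine[of c x])
      (simp_all add: nn_integral_density nn_integral_distr nn_integral_cmult)
qed

text \<open>Averaging \<open>F\<close> against a narrow Gaussian about \<open>x\<close>, and then
  over \<open>P\<close>, amounts by Fubini to integrating \<open>F\<close> against a smoothing of
  \<open>P\<close>, up to a constant. So these averages agree for \<open>P\<close> and
  \<open>Q\<close>, and they tend to the integrals of \<open>F\<close> as the width shrinks.\<close>

lemma nn_integral_eq_if_gaussian_smoothings_eq:
  fixes P Q :: "'a::euclidean_space measure" and F :: "'a \<Rightarrow> real"
  assumes "prob_space P" "prob_space Q" and sets: "sets P = sets borel" "sets Q = sets borel"
    and eq: "\<And>s w. s > 0 \<Longrightarrow>
      (\<integral>x. exp (-(s * (norm (x - w))\<^sup>2)) \<partial>P) = (\<integral>x. exp (-(s * (norm (x - w))\<^sup>2)) \<partial>Q)"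
    and F: "continuous_on UNIV F" "\<And>x. 0 \<le> F x" "\<And>x. F x \<le> 1"
  shows "(\<integral>\<^sup>+x. ennreal (F x) \<partial>P) = (\<integral>\<^sup>+x. ennreal (F x) \<partial>Q)"
proof -
  have Fm [measurable]: "F \<in> borel_measurable borel"
    using F(1) by (rule borel_measurable_continuous_onI)
  \<comment> \<open>The Gaussian weight is left unnormalised; its total mass \<open>?I\<close> is
    positive and finite and cancels at the end.\<close>
  let ?I = "ennreal (sqrt pi ^ DIM('a))"
  have I: "(\<integral>\<^sup>+y. ennreal (exp (-((norm y)\<^sup>2))) \<partial>(lborel :: 'a measure)) = ?I"
    using nn_integral_gaussian[of 1 "0::'a"] by simp
  define J where "J c x = (\<integral>\<^sup>+y. ennreal (F (x + c *\<^sub>R y)) * ennreal (exp (-((norm y)\<^sup>2))) \<partial>lborel)"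
    for c x
  have J_meas [measurable]: "J c \<in> borel_measurable borel" for c
    unfolding J_def by measurable
  \<comment> \<open>Bandwidths that tend to zero; \<open>Suc\<close> keeps them positive from
    \<open>k = 0\<close> on.\<close>
  let ?c = "\<lambda>k. 1 / real (Suc k)"
  have "(\<lambda>k. J (?c k) x) \<longlonglongrightarrow> (\<integral>\<^sup>+y. ennreal (F x) * ennreal (exp (-((norm y)\<^sup>2))) \<partial>(lborel::'a measure))" for x
    unfolding J_def
  proof (rule nn_integral_dominated_convergence[where w = "\<lambda>y. ennreal (exp (-((norm y)\<^sup>2)))"])
    show "AE y in (lborel::'a measure). (\<lambda>k. ennreal (F (x + ?c k *\<^sub>R y)) * ennreal (exp (-((norm y)\<^sup>2))))
        \<longlonglongrightarrow> ennreal (F x) * ennreal (exp (-((norm y)\<^sup>2)))"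
    proof (rule AE_I2)
      fix y :: 'a
      have "(\<lambda>k. x + ?c k *\<^sub>R y) \<longlonglongrightarrow> x + 0 *\<^sub>R y"
        using LIMSEQ_inverse_real_of_nat
        by (intro tendsto_intros) (simp add: inverse_eq_divide)
      then have "(\<lambda>k. F (x + ?c k *\<^sub>R y)) \<longlonglongrightarrow> F x"
        using F(1) by (auto intro: continuous_on_tendsto_compose)
      then show "(\<lambda>k. ennreal (F (x + ?c k *\<^sub>R y)) * ennreal (exp (-((norm y)\<^sup>2))))
          \<longlonglongrightarrow> ennreal (F x) * ennreal (exp (-((norm y)\<^sup>2)))"
        using F(2) by (simp add: tendsto_mult_right tendsto_ennrealI flip: ennreal_mult)
    qed
    show "AE y in (lborel::'a measure). ennreal (F (x + ?c j *\<^sub>R y)) * ennreal (exp (-((norm y)\<^sup>2)))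
        \<le> ennreal (exp (-((norm y)\<^sup>2)))" for j
      using F(2,3) by (auto simp: mult_left_le_one_le intro!: ennreal_leI simp flip: ennreal_mult)
  qed (auto simp: I)
  then have J_lim: "(\<lambda>k. J (?c k) x) \<longlonglongrightarrow> ennreal (F x) * ?I" for x
    by (simp add: nn_integral_cmult I)
  have J_le: "J c x \<le> ?I" for c x
  proof -
    have "J c x \<le> (\<integral>\<^sup>+y. ennreal (exp (-((norm y)\<^sup>2))) \<partial>(lborel :: 'a measure))"
      unfolding J_def using F(2,3)
      by (intro nn_integral_mono) (auto simp: mult_left_le_one_le intro!: ennreal_leI simp flip: ennreal_mult)
    then show ?thesis by (simp add: I)
  qed
  have lim: "(\<lambda>k. \<integral>\<^sup>+x. J (?c k) x \<partial>M) \<longlonglongrightarrow> (\<integral>\<^sup>+x. ennreal (F x) \<partial>M) * ?I"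
    if "prob_space M" "sets M = sets borel" for M :: "'a measure"
  proof -
    interpret prob_space M by fact
    note [measurable_cong] = that(2)
    have "(\<lambda>k. \<integral>\<^sup>+x. J (?c k) x \<partial>M) \<longlonglongrightarrow> (\<integral>\<^sup>+x. ennreal (F x) * ?I \<partial>M)"
      by (rule nn_integral_dominated_convergence[where w = "\<lambda>_. ?I"])
        (auto simp: J_le J_lim emeasure_space_1 simp del: of_nat_Suc)
    then show ?thesis by (simp add: nn_integral_multc)
  qed
  \<comment> \<open>The right-hand side sees \<open>M\<close> only through its Gaussian smoothings
    with parameter \<open>(1 / c)\<^sup>2\<close>, which is how the hypothesis on smoothings reaches
    \<open>J\<close>.\<close>
  have J_smooth: "ennreal (c ^ DIM('a)) * (\<integral>\<^sup>+x. J c x \<partial>M) =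
      (\<integral>\<^sup>+w. ennreal (F w) * ennreal (\<integral>x. exp (-((1 / c)\<^sup>2 * (norm (x - w))\<^sup>2)) \<partial>M) \<partial>lborel)"
    if "prob_space M" "sets M = sets borel" "c > 0" for M :: "'a measure" and c
  proof -
    interpret prob_space M by fact
    interpret M_lborel: pair_sigma_finite M "lborel :: 'a measure" ..
    note [measurable_cong] = that(2)
    have "ennreal (\<integral>x. exp (-((1 / c)\<^sup>2 * (norm (x - w))\<^sup>2)) \<partial>M) =
        (\<integral>\<^sup>+x. ennreal (exp (-((1 / c)\<^sup>2 * (norm (x - w))\<^sup>2))) \<partial>M)" for w
      by (intro nn_integral_eq_integral[symmetric] integrable_const_bound[where B = 1]) auto
    then have "(\<integral>\<^sup>+w. ennreal (F w) * ennreal (\<integral>x. exp (-((1 / c)\<^sup>2 * (norm (x - w))\<^sup>2)) \<partial>M) \<partial>lborel) =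
        (\<integral>\<^sup>+w. (\<integral>\<^sup>+x. ennreal (F w) * ennreal (exp (-((1 / c)\<^sup>2 * (norm (x - w))\<^sup>2))) \<partial>M) \<partial>lborel)"
      by (simp add: nn_integral_cmult)
    also have "\<dots> = (\<integral>\<^sup>+x. (\<integral>\<^sup>+w. ennreal (F w) * ennreal (exp (-((1 / c)\<^sup>2 * (norm (x - w))\<^sup>2))) \<partial>lborel) \<partial>M)"
      by (rule M_lborel.Fubini') measurable
    also have "\<dots> = (\<integral>\<^sup>+x. ennreal (c ^ DIM('a)) * J c x \<partial>M)"
      using that(3) by (simp add: nn_integral_gaussian_dilate J_def)
    finally show ?thesis by (simp add: nn_integral_cmult)
  qed
  have "(\<integral>\<^sup>+x. J (?c k) x \<partial>P) = (\<integral>\<^sup>+x. J (?c k) x \<partial>Q)" for k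
  proof -
    have "ennreal (?c k ^ DIM('a)) * (\<integral>\<^sup>+x. J (?c k) x \<partial>P) =
        ennreal (?c k ^ DIM('a)) * (\<integral>\<^sup>+x. J (?c k) x \<partial>Q)"
      by (subst (1 2) J_smooth) (use assms in \<open>auto simp: eq\<close>)
    then show ?thesis by (simp add: ennreal_mult_cancel_left)
  qed
  then have "(\<integral>\<^sup>+x. ennreal (F x) \<partial>P) * ?I = (\<integral>\<^sup>+x. ennreal (F x) \<partial>Q) * ?I"
    using lim[OF assms(1) sets(1)] lim[OF assms(2) sets(2)] by (simp add: LIMSEQ_unique)
  then show ?thesis
    by (simp add: ennreal_mult_cancel_left mult.commute[of _ ?I])
qed

text \<open>Closed sets are stable under intersection and generate the Borel sets, and the indicator
  of a nonempty closed set is a pointwise limit of continuous functions with values between 0 and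
  1.\<close>

lemma borel_measure_eqI_continuous:
  fixes P Q :: "'a::metric_space measure"
  assumes "prob_space P" "prob_space Q" and sets: "sets P = sets borel" "sets Q = sets borel"
    and eq: "\<And>F :: 'a \<Rightarrow> real. continuous_on UNIV F \<Longrightarrow> (\<And>x. 0 \<le> F x) \<Longrightarrow> (\<And>x. F x \<le> 1) \<Longrightarrow>
      (\<integral>\<^sup>+x. ennreal (F x) \<partial>P) = (\<integral>\<^sup>+x. ennreal (F x) \<partial>Q)"
  shows "P = Q"
proof (rule measure_eqI_generator_eq[where E = "Collect closed" and \<Omega> = UNIV and A = "\<lambda>_. UNIV"])
  interpret P: prob_space P by fact
  interpret Q: prob_space Q by fact
  show "emeasure P A = emeasure Q A" if "A \<in> Collect closed" for A
  proof (cases "A = {}")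
    case False
    have A: "closed A" using that by simp
    then have Ab [measurable]: "A \<in> sets borel" by simp
    \<comment> \<open>A cutoff falling with slope \<open>k\<close> in the distance from
      \<open>A\<close>: it is 1 on \<open>A\<close>, and at each point outside it is eventually 0
      because \<open>A\<close> is closed. The empty set is treated apart since
      \<open>infdist\<close> to it is 0 by convention.\<close>
    define F where "F k x = max 0 (1 - real k * infdist x A)" for k x
    have F: "continuous_on UNIV (F k)" "0 \<le> F k x" "F k x \<le> 1" for k x
      unfolding F_def by (auto intro!: continuous_intros simp: infdist_nonneg)
    have [measurable]: "F k \<in> borel_measurable borel" for k
      using F(1) by (rule borel_measurable_continuous_onI)
    have F_lim: "(\<lambda>k. ennreal (F k x)) \<longlonglongrightarrow> indicator A x" for x
    proof (cases "x \<in> A")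
      case True
      then show ?thesis by (simp add: F_def)
    next
      case x: False
      then have "infdist x A > 0"
        using A False by (metis in_closed_iff_infdist_zero infdist_nonneg less_eq_real_def)
      then obtain n :: nat where n: "1 < real n * infdist x A"
        using reals_Archimedean3 by blast
      have "F k x = 0" if "k \<ge> n" for k
      proof -
        have "real n * infdist x A \<le> real k * infdist x A"
          using that by (intro mult_right_mono) (auto simp: infdist_nonneg)
        then show ?thesis using n by (simp add: F_def)
      qed
      then have "\<forall>\<^sub>F k in sequentially. ennreal (F k x) = 0"
        by (auto simp: eventually_sequentially intro!: exI[of _ n])
      then show ?thesis using x by (simp add: tendsto_eventually)
    qed
    have lim: "(\<lambda>k. \<integral>\<^sup>+x. ennreal (F k x) \<partial>M) \<longlonglongrightarrow> emeasure M A"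
      if "prob_space M" "sets M = sets borel" for M :: "'a measure"
    proof -
      interpret prob_space M by fact
      note [measurable_cong] = that(2)
      have "(\<lambda>k. \<integral>\<^sup>+x. ennreal (F k x) \<partial>M) \<longlonglongrightarrow> (\<integral>\<^sup>+x. indicator A x \<partial>M)"
        by (rule nn_integral_dominated_convergence[where w = "\<lambda>_. 1"])
          (auto simp: F F_lim emeasure_space_1)
      then show ?thesis by simp
    qed
    have "(\<integral>\<^sup>+x. ennreal (F k x) \<partial>P) = (\<integral>\<^sup>+x. ennreal (F k x) \<partial>Q)" for k
      by (intro eq F)
    then show ?thesis
      using lim[OF assms(1) sets(1)] lim[OF assms(2) sets(2)] by (simp add: LIMSEQ_unique)
  qed simp
  have "sets borel = sigma_sets UNIV (Collect (closed :: 'a set \<Rightarrow> bool))"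
    unfolding borel_eq_closed by simp
  then show "sets P = sigma_sets UNIV (Collect closed)" "sets Q = sigma_sets UNIV (Collect closed)"
    using sets by simp_all
  show "emeasure P UNIV \<noteq> \<infinity>" using P.emeasure_finite by simp
qed (auto simp: Int_stable_def)


section \<open>Zero discrepancy for the product kernel forces equality\<close>

text \<open>The Gaussian factor is at most one. The bound is free of \<open>x\<close>, as required
  of the envelope \<open>W\<close> in \<open>MMD2_eq_0_imp_features_AE_eq\<close>.\<close>

lemma imq_feature_le:
  fixes x :: "'a::euclidean_space"
  assumes "C > 0"
  shows "imq_feature C x p \<le> (if fst p > 0
     then sqrt (C * exp (-(fst p * C)) * sqrt (4 * fst p / pi) ^ DIM('a)) else 0)"
  using assms by (auto simp: imq_feature_def intro!: mult_left_le simp del: real_sqrt_mult)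

text \<open>The two factors of the kernel have separate parameters \<open>fst \<omega>\<close> and
  \<open>snd \<omega>\<close>, so the integral splits into two integrals over single
  features.\<close>

lemma nn_integral_pair_imq_feature:
  fixes x y :: "'a::euclidean_space \<times> 'b::euclidean_space"
  assumes C: "C > 0"
  shows "(\<integral>\<^sup>+\<omega>. ennreal (imq_feature C (fst x) (fst \<omega>) * imq_feature C (snd x) (snd \<omega>)
      * (imq_feature C (fst y) (fst \<omega>) * imq_feature C (snd y) (snd \<omega>))) \<partial>lborel)
    = ennreal (pair_kernel (imq_kernel C) (imq_kernel C) x y)"
proof -
  let ?u = "\<lambda>p. ennreal (imq_feature C (fst x) p * imq_feature C (fst y) p)"
  let ?v = "\<lambda>p. ennreal (imq_feature C (snd x) p * imq_feature C (snd y) p)"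
  have "(\<integral>\<^sup>+\<omega>. ennreal (imq_feature C (fst x) (fst \<omega>) * imq_feature C (snd x) (snd \<omega>)
      * (imq_feature C (fst y) (fst \<omega>) * imq_feature C (snd y) (snd \<omega>))) \<partial>lborel) =
      (\<integral>\<^sup>+\<omega>. ?u (fst \<omega>) * ?v (snd \<omega>) \<partial>(lborel \<Otimes>\<^sub>M lborel))"
    unfolding lborel_prod
    by (simp add: imq_feature_nonneg[OF C] mult_ac flip: ennreal_mult)
  also have "\<dots> = (\<integral>\<^sup>+p. \<integral>\<^sup>+q. ?u p * ?v q \<partial>lborel \<partial>lborel)"
    by (subst lborel.nn_integral_fst[symmetric]) auto
  also have "\<dots> = (\<integral>\<^sup>+p. ?u p \<partial>lborel) * (\<integral>\<^sup>+q. ?v q \<partial>lborel)"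
    by (simp add: nn_integral_cmult nn_integral_multc)
  finally show ?thesis
    by (simp add: nn_integral_imq_feature[OF C] pair_kernel_def ennreal_mult
        less_imp_le[OF imq_kernel_pos[OF C]])
qed

text \<open>Product features yield Gaussians with a separate width in each component. Equal widths
  give the isotropic Gaussians on the product space, whose smoothings determine the measure.\<close>

lemma MMD2_pair_imq_kernel_eq_0_imp_eq:
  fixes P Q :: "('a::euclidean_space \<times> 'b::euclidean_space) measure"
  assumes "prob_space P" "prob_space Q" and sets: "sets P = sets borel" "sets Q = sets borel"
    and C: "C > 0" and MMD: "MMD2 (pair_kernel (imq_kernel C) (imq_kernel C)) P Q = 0"
  shows "P = Q"
proof -
  interpret P: prob_space P by fact
  interpret Q: prob_space Q by fact
  define \<psi> :: "'a \<times> 'b \<Rightarrow> (real \<times> 'a) \<times> (real \<times> 'b) \<Rightarrow> real" where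
    "\<psi> x \<omega> = imq_feature C (fst x) (fst \<omega>) * imq_feature C (snd x) (snd \<omega>)" for x \<omega>
  let ?W = "\<lambda>\<omega> :: (real \<times> 'a) \<times> (real \<times> 'b).
     (if fst (fst \<omega>) > 0 then sqrt (C * exp (-(fst (fst \<omega>) * C)) * sqrt (4 * fst (fst \<omega>) / pi) ^ DIM('a)) else 0)
     * (if fst (snd \<omega>) > 0 then sqrt (C * exp (-(fst (snd \<omega>) * C)) * sqrt (4 * fst (snd \<omega>) / pi) ^ DIM('b)) else 0)"
  have AE: "AE \<omega> in lborel. (\<integral>x. \<psi> x \<omega> \<partial>P) = (\<integral>x. \<psi> x \<omega> \<partial>Q)"
  proof (rule MMD2_eq_0_imp_features_AE_eq[where N = borel and W = ?W and B = 1, OF assms(1,2) sets _ _ _ _ _ _ _ _ MMD])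
    show "sigma_finite_measure (lborel :: ((real \<times> 'a) \<times> (real \<times> 'b)) measure)"
      by (rule sigma_finite_lborel)
    show "(\<lambda>q. \<psi> (fst q) (snd q)) \<in> borel_measurable (borel \<Otimes>\<^sub>M lborel)"
    proof -
      have "(\<lambda>q. \<psi> (fst q) (snd q)) \<in> borel_measurable borel"
        unfolding \<psi>_def
        by (intro borel_measurable_times borel_measurable_imq_feature borel_measurable_continuous_onI
            continuous_intros)
      then show ?thesis
        unfolding measurable_cong_sets[OF sets_pair_measure_cong[OF refl sets_lborel] refl] borel_prod .
    qed
    show "(\<lambda>q. pair_kernel (imq_kernel C) (imq_kernel C) (fst q) (snd q))
        \<in> borel_measurable (borel \<Otimes>\<^sub>M (borel :: ('a \<times> 'b) measure))"
      unfolding pair_kernel_def imq_kernel_def borel_prod[symmetric] by measurable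
    show "0 \<le> \<psi> x \<omega>" for x \<omega>
      unfolding \<psi>_def by (intro mult_nonneg_nonneg imq_feature_nonneg C)
    show "\<psi> x \<omega> \<le> ?W \<omega>" for x \<omega>
      unfolding \<psi>_def
      by (rule mult_mono[OF imq_feature_le[OF C] imq_feature_le[OF C] _ imq_feature_nonneg[OF C]])
        (use C in auto)
    show "0 \<le> pair_kernel (imq_kernel C) (imq_kernel C) x y" for x y :: "'a \<times> 'b"
      unfolding pair_kernel_def by (intro mult_nonneg_nonneg less_imp_le imq_kernel_pos C)
    show "pair_kernel (imq_kernel C) (imq_kernel C) x y \<le> 1" for x y :: "'a \<times> 'b"
      unfolding pair_kernel_def by (intro mult_le_one less_imp_le imq_kernel_pos imq_kernel_le_1 C)
    show "(\<integral>\<^sup>+\<omega>. ennreal (\<psi> x \<omega> * \<psi> y \<omega>) \<partial>lborel) =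
        ennreal (pair_kernel (imq_kernel C) (imq_kernel C) x y)" for x y :: "'a \<times> 'b"
      unfolding \<psi>_def by (rule nn_integral_pair_imq_feature[OF C])
  qed
  \<comment> \<open>The Gaussian part of \<open>\<psi>\<close> without the weights: it is
    continuous, and bounded by 1 on the set \<open>S\<close> where both mixing parameters are
    positive.\<close>
  define G :: "'a \<times> 'b \<Rightarrow> (real \<times> 'a) \<times> (real \<times> 'b) \<Rightarrow> real" where
    "G x \<omega> = exp (-(2 * fst (fst \<omega>) * (norm (fst x - snd (fst \<omega>)))\<^sup>2))
      * exp (-(2 * fst (snd \<omega>) * (norm (snd x - snd (snd \<omega>)))\<^sup>2))" for x \<omega>
  have G_meas: "(\<lambda>x. G x \<omega>) \<in> borel_measurable borel" for \<omega>
    unfolding G_def by (intro borel_measurable_continuous_onI continuous_intros)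
  define S :: "((real \<times> 'a) \<times> (real \<times> 'b)) set" where "S = ({0<..} \<times> UNIV) \<times> ({0<..} \<times> UNIV)"
  define h where "h \<omega> = (\<integral>x. G x \<omega> \<partial>P) - (\<integral>x. G x \<omega> \<partial>Q)" for \<omega>
  have cont: "continuous_on S (\<lambda>\<omega>. \<integral>x. G x \<omega> \<partial>M)" if "prob_space M" "sets M = sets borel" for M
  proof (rule continuous_on_integral_of_bounded[where B = 1])
    show "finite_measure M" using that(1) by (rule prob_space.finite_measure)
    show "\<bar>G x \<omega>\<bar> \<le> 1" if "\<omega> \<in> S" for x \<omega>
      using that unfolding G_def S_def by (auto simp: abs_mult intro!: mult_le_one)
    show "(\<lambda>x. G x \<omega>) \<in> borel_measurable M" for \<omega>
      using G_meas measurable_cong_sets[OF that(2) refl] by blast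
  qed (auto simp: G_def intro!: continuous_intros)
  have "continuous_on S h"
    unfolding h_def by (intro continuous_intros cont assms)
  moreover have "AE \<omega> in lborel. \<omega> \<in> S \<longrightarrow> h \<omega> = 0"
    using AE
  proof eventually_elim
    case (elim \<omega>)
    show ?case
    proof
      assume \<omega>: "\<omega> \<in> S"
      \<comment> \<open>The weights depend on \<open>\<omega>\<close> only and are positive on
        \<open>S\<close>, so they factor out of both means and cancel.\<close>
      let ?a = "sqrt (C * exp (-(fst (fst \<omega>) * C)) * sqrt (4 * fst (fst \<omega>) / pi) ^ DIM('a))
        * sqrt (C * exp (-(fst (snd \<omega>) * C)) * sqrt (4 * fst (snd \<omega>) / pi) ^ DIM('b))"
      have pos: "fst (fst \<omega>) > 0" "fst (snd \<omega>) > 0" using \<omega> by (auto simp: S_def)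
      have "\<psi> x \<omega> = ?a * G x \<omega>" for x
        unfolding \<psi>_def imq_feature_def G_def using pos by (simp del: real_sqrt_mult)
      moreover have "?a > 0"
        using C pos by (simp del: real_sqrt_mult)
      ultimately show "h \<omega> = 0"
        using elim C pos by (simp add: h_def del: real_sqrt_mult)
    qed
  qed
  moreover have "open S"
    unfolding S_def by (intro open_Times) auto
  ultimately have zero: "h \<omega> = 0" if "\<omega> \<in> S" for \<omega>
    using continuous_on_AE_lborel_eq_0 that by blast
  have smooth: "(\<integral>x. exp (-(s * (norm (x - w))\<^sup>2)) \<partial>P) = (\<integral>x. exp (-(s * (norm (x - w))\<^sup>2)) \<partial>Q)"
    if "s > 0" for s w
  proof -
    \<comment> \<open>Halving \<open>s\<close> compensates for the factor 2 in the exponent of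
      \<open>G\<close>; the squared norm of a pair is the sum of the squared norms of its
      components.\<close>
    have "G x ((s / 2, fst w), (s / 2, snd w)) = exp (-(s * (norm (x - w))\<^sup>2))" for x
      by (simp add: G_def norm_prod_def mult_exp_exp algebra_simps)
    then show ?thesis
      using zero[of "((s / 2, fst w), (s / 2, snd w))"] that by (simp add: h_def S_def)
  qed
  show ?thesis
    by (rule borel_measure_eqI_continuous[OF assms(1,2) sets],
        rule nn_integral_eq_if_gaussian_smoothings_eq[OF assms(1,2) sets smooth])
qed

section \<open>Continuity of invertible networks and their inverses\<close>

lemma continuous_on_split_vec [continuous_intros]:
  "continuous_on A g \<Longrightarrow> continuous_on A (\<lambda>x. split_vec (g x))"
  unfolding split_vec_def by (intro continuous_intros)

lemma continuous_on_join_vec [continuous_intros]: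
  assumes "continuous_on A g"
  shows "continuous_on A (\<lambda>x. join_vec (g x))"
  unfolding join_vec_def
proof (rule continuous_on_vec_lambda)
  show "continuous_on A (\<lambda>x. case k of Inl i \<Rightarrow> fst (g x) $ i | Inr j \<Rightarrow> snd (g x) $ j)" for k
    using assms by (cases k) (auto intro!: continuous_intros)
qed

lemma inv_split_vec: "inv split_vec = join_vec"
  by (rule inv_unique_comp)
    (auto simp: split_vec_def join_vec_def vec_eq_iff fun_eq_iff split: sum.split)

lemma inv_join_vec: "inv join_vec = split_vec"
  using inv_split_vec bij_split_vec by (metis inv_inv_eq)

lemma continuous_on_permute_coords:
  "continuous_on UNIV (permute_coords \<pi>)"
  unfolding permute_coords_def by (intro continuous_intros)

lemma inv_permute_coords:
  "bij \<pi> \<Longrightarrow> inv (permute_coords \<pi>) = permute_coords (inv \<pi>)"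
  by (rule inv_unique_comp)
    (auto simp: permute_coords_def vec_eq_iff fun_eq_iff bij_is_inj bij_is_surj surj_f_inv_f)

lemma continuous_on_coupling_block:
  assumes "continuous_on UNIV \<phi>" "continuous_on UNIV \<rho>" "continuous_on UNIV \<eta>"
  shows "continuous_on UNIV (coupling_block \<phi> \<rho> \<eta>)"
  unfolding coupling_block_def Let_def
  by (intro continuous_intros continuous_on_compose2[OF assms(1)] continuous_on_compose2[OF assms(2)]
      continuous_on_compose2[OF assms(3)]) auto

text \<open>The first output is the argument of \<open>\<rho>\<close> and \<open>\<eta>\<close>, so
  scaling and shift can be undone to recover the second input \<open>k\<close>; then
  \<open>\<phi> k\<close> is known and subtracted. The subnetworks themselves are never
  inverted.\<close>

lemma inv_coupling_block:
  "inv (coupling_block \<phi> \<rho> \<eta>) =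
    (\<lambda>h. let k = (\<chi> j. (snd h $ j - \<eta> (fst h) $ j) / exp (\<rho> (fst h) $ j)) in (fst h - \<phi> k, k))"
  by (rule inv_unique_comp) (auto simp: coupling_block_def vec_eq_iff Let_def fun_eq_iff)

lemma continuous_on_inv_coupling_block:
  assumes "continuous_on UNIV \<phi>" "continuous_on UNIV \<rho>" "continuous_on UNIV \<eta>"
  shows "continuous_on UNIV (inv (coupling_block \<phi> \<rho> \<eta>))"
  unfolding inv_coupling_block Let_def
  by (intro continuous_intros continuous_on_compose2[OF assms(1)] continuous_on_compose2[OF assms(2)]
      continuous_on_compose2[OF assms(3)]) auto

lemma linear_inv_bij: "linear L \<Longrightarrow> bij L \<Longrightarrow> linear (inv L)"
  for L :: "'a::euclidean_space \<Rightarrow> 'a"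
  by (metis bij_is_inj bij_is_surj inj_linear_imp_inv_linear)

text \<open>Supplies the Borel measurability of \<open>f\<close> and \<open>inv f\<close>. Both
  directions go through the induction together, the inverse being the composition of the inverse
  factors in reverse order.\<close>

lemma invertible_nn_continuous:
  assumes "invertible_nn f"
  shows "continuous_on UNIV f \<and> continuous_on UNIV (inv f)"
  using assms
proof induction
  case (preprocess L)
  have "continuous_on UNIV (split_vec \<circ> L)"
    using linear_continuous_on[OF linear_conv_bounded_linear[THEN iffD1, OF preprocess(1)]]
    by (auto simp: comp_def intro: continuous_intros)
  moreover have eq: "inv (split_vec \<circ> L) = inv L \<circ> join_vec"
    by (simp add: o_inv_distrib bij_split_vec preprocess(2) inv_split_vec)
  moreover have "continuous_on UNIV (inv L)"
    using linear_inv_bij[OF preprocess] by (simp add: linear_continuous_on linear_conv_bounded_linear)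
  then have "continuous_on UNIV (inv L \<circ> join_vec)"
    by (auto simp: comp_def intro!: continuous_on_compose2[of UNIV "inv L"] continuous_intros)
  ultimately show ?case unfolding eq by blast
next
  case (block f \<pi> \<phi> \<rho> \<eta>)
  note bijs = bij_coupling_block bij_split_vec bij_permute_coords[OF block(2)] bij_join_vec
    invertible_nn_bij[OF block(1)] bij_comp
  have split: "continuous_on UNIV split_vec" and join: "continuous_on UNIV join_vec"
    by (intro continuous_intros)+
  note c = continuous_on_compose[OF _ continuous_on_subset[OF _ subset_UNIV]]
  have "continuous_on UNIV (coupling_block \<phi> \<rho> \<eta> \<circ> split_vec \<circ> permute_coords \<pi> \<circ> join_vec \<circ> f)"
    using block by (intro c continuous_on_coupling_block split join continuous_on_permute_coords) auto
  moreover have eq: "inv (coupling_block \<phi> \<rho> \<eta> \<circ> split_vec \<circ> permute_coords \<pi> \<circ> join_vec \<circ> f) =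
      inv f \<circ> (split_vec \<circ> (permute_coords (inv \<pi>) \<circ> (join_vec \<circ> inv (coupling_block \<phi> \<rho> \<eta>))))"
    by (simp add: o_inv_distrib bijs inv_split_vec inv_join_vec inv_permute_coords block(2))
  moreover have "continuous_on UNIV
      (inv f \<circ> (split_vec \<circ> (permute_coords (inv \<pi>) \<circ> (join_vec \<circ> inv (coupling_block \<phi> \<rho> \<eta>)))))"
    using block by (intro c continuous_on_inv_coupling_block split join continuous_on_permute_coords) auto
  ultimately show ?case unfolding eq by blast
qed

section \<open>Independence and the law of the reconstruction\<close>

text \<open>Rectangles determine a product measure. The preimage of \<open>A \<times> B\<close> is
  an intersection of independent events, because a preimage under \<open>u (X \<omega>)\<close> is
  already a preimage under \<open>X\<close>.\<close>

lemma (in prob_space) distr_Pair_of_indep_vimage_algebra: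
  assumes X: "X \<in> measurable M S" and Y: "Y \<in> measurable M T" and u: "u \<in> measurable S S'"
    and indep: "indep_set (sets (vimage_algebra (space M) X S)) (sets (vimage_algebra (space M) Y T))"
  shows "distr M (S' \<Otimes>\<^sub>M T) (\<lambda>\<omega>. (u (X \<omega>), Y \<omega>)) =
    distr M S' (\<lambda>\<omega>. u (X \<omega>)) \<Otimes>\<^sub>M distr M T Y"
proof (rule pair_measure_eqI[symmetric])
  note [measurable] = X Y u
  interpret uX: prob_space "distr M S' (\<lambda>\<omega>. u (X \<omega>))"
    by (rule prob_space_distr) measurable
  interpret Y: prob_space "distr M T Y"
    by (rule prob_space_distr) measurable
  show "sigma_finite_measure (distr M S' (\<lambda>\<omega>. u (X \<omega>)))" "sigma_finite_measure (distr M T Y)"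
    by unfold_locales
  fix A B assume "A \<in> sets (distr M S' (\<lambda>\<omega>. u (X \<omega>)))" "B \<in> sets (distr M T Y)"
  then have [measurable]: "A \<in> sets S'" "B \<in> sets T" by auto
  let ?A = "X -` (u -` A \<inter> space S) \<inter> space M" and ?B = "Y -` B \<inter> space M"
  have "prob (?A \<inter> ?B) = prob ?A * prob ?B"
    by (rule indep_setD[OF indep]; rule in_vimage_algebra) measurable
  moreover have "?A = (\<lambda>\<omega>. u (X \<omega>)) -` A \<inter> space M"
    using measurable_space[OF X] by auto
  moreover have "(\<lambda>\<omega>. (u (X \<omega>), Y \<omega>)) -` (A \<times> B) \<inter> space M = ?A \<inter> ?B"
    using measurable_space[OF X] by auto
  ultimately show "emeasure (distr M S' (\<lambda>\<omega>. u (X \<omega>))) A * emeasure (distr M T Y) B =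
      emeasure (distr M (S' \<Otimes>\<^sub>M T) (\<lambda>\<omega>. (u (X \<omega>), Y \<omega>))) (A \<times> B)"
    by (simp add: emeasure_distr emeasure_eq_measure flip: ennreal_mult)
qed simp

theorem theorem2:
  fixes p_H :: "(real, 'm::finite + 'r::finite) vec measure"
    and f :: "(real, 'm + 'r) vec \<Rightarrow> (real ^ 'm) \<times> (real ^ 'r)"
    and C :: real
    and \<Omega> :: "'w measure"
    and H :: "'w \<Rightarrow> (real, 'm + 'r) vec"
    and R :: "'w \<Rightarrow> real ^ 'r"
  assumes "C > 0"
    and "prob_space p_H" and "sets p_H = sets borel"
    and "invertible_nn f"
    and "MMD2 (pair_kernel (imq_kernel C) (imq_kernel C))
           (distr p_H borel (\<lambda>h. (fst (f h), snd (f h))))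
           (distr p_H borel (\<lambda>h. fst (f h)) \<Otimes>\<^sub>M std_gaussian) = 0"
    and "prob_space \<Omega>"
    and "H \<in> borel_measurable \<Omega>" and "distr \<Omega> borel H = p_H"
    and "R \<in> borel_measurable \<Omega>" and "distr \<Omega> borel R = std_gaussian"
    and "prob_space.indep_set \<Omega> (sets (vimage_algebra (space \<Omega>) H borel))
           (sets (vimage_algebra (space \<Omega>) R borel))"
  shows "MMD2 (imq_kernel C)
           (distr \<Omega> borel (\<lambda>\<omega>. inv f (fst (f (H \<omega>)), R \<omega>))) p_H = 0"
proof -
  interpret \<Omega>: prob_space \<Omega> by fact
  interpret p_H: prob_space p_H by fact
  note [measurable] = assms(7,9)
  note [measurable_cong] = assms(3)
  have f_meas [measurable]: "f \<in> borel_measurable borel" "inv f \<in> borel_measurable borel"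
    using invertible_nn_continuous[OF assms(4)] by (auto intro: borel_measurable_continuous_onI)
  have fst_meas [measurable]: "(\<lambda>h. fst (f h)) \<in> borel_measurable borel"
    by (rule measurable_compose[OF f_meas(1)]) (intro borel_measurable_continuous_onI continuous_intros)
  \<comment> \<open>Total mass one is inherited from \<open>\<Omega>\<close>, as
    \<open>std_gaussian\<close> is the distribution of \<open>R\<close>.\<close>
  interpret G: prob_space "std_gaussian :: (real ^ 'r) measure"
    unfolding assms(10)[symmetric] by (rule \<Omega>.prob_space_distr) measurable
  have sets_G [measurable_cong]: "sets (std_gaussian :: (real ^ 'r) measure) = sets borel"
    by (simp add: std_gaussian_def)
  let ?pz = "distr p_H borel (\<lambda>h. fst (f h))"
  interpret pz: prob_space ?pz
    by (rule p_H.prob_space_distr) measurable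
  interpret prod: pair_prob_space ?pz "std_gaussian :: (real ^ 'r) measure" ..
  \<comment> \<open>The zero loss enters here; the pair \<open>(fst (f h), snd (f h))\<close> in it
    is \<open>f h\<close>.\<close>
  have "distr p_H borel f = ?pz \<Otimes>\<^sub>M std_gaussian"
  proof (rule MMD2_pair_imq_kernel_eq_0_imp_eq[OF _ _ _ _ assms(1)])
    show "prob_space (distr p_H borel f)" by (rule p_H.prob_space_distr) measurable
    show "prob_space (?pz \<Otimes>\<^sub>M (std_gaussian :: (real ^ 'r) measure))"
      by (rule prod.P.prob_space_axioms)
    show "sets (?pz \<Otimes>\<^sub>M (std_gaussian :: (real ^ 'r) measure)) = sets borel"
      unfolding borel_prod[symmetric] by (intro sets_pair_measure_cong) (simp_all add: sets_G)
  qed (use assms(5) in simp_all)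
  \<comment> \<open>Independence of \<open>H\<close> and \<open>R\<close> passes to
    \<open>fst (f (H \<omega>))\<close> and \<open>R \<omega>\<close>, and the former has law
    \<open>?pz\<close> since \<open>H\<close> has law \<open>p_H\<close>.\<close>
  also have "\<dots> = distr \<Omega> (borel \<Otimes>\<^sub>M borel) (\<lambda>\<omega>. (fst (f (H \<omega>)), R \<omega>))"
  proof -
    have "distr \<Omega> (borel \<Otimes>\<^sub>M borel) (\<lambda>\<omega>. (fst (f (H \<omega>)), R \<omega>)) =
        distr \<Omega> borel (\<lambda>\<omega>. fst (f (H \<omega>))) \<Otimes>\<^sub>M distr \<Omega> borel R"
      by (rule \<Omega>.distr_Pair_of_indep_vimage_algebra[OF assms(7,9) fst_meas assms(11)])
    also have "distr \<Omega> borel (\<lambda>\<omega>. fst (f (H \<omega>))) = ?pz"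
      unfolding assms(8)[symmetric] by (simp add: distr_distr comp_def)
    finally show ?thesis using assms(10) by simp
  qed
  finally have joint: "distr p_H borel f = distr \<Omega> borel (\<lambda>\<omega>. (fst (f (H \<omega>)), R \<omega>))"
    by (simp add: borel_prod)
  have pair_meas [measurable]: "(\<lambda>\<omega>. (fst (f (H \<omega>)), R \<omega>)) \<in> borel_measurable \<Omega>"
    unfolding borel_prod[symmetric] by measurable
  have "distr \<Omega> borel (\<lambda>\<omega>. inv f (fst (f (H \<omega>)), R \<omega>)) =
      distr (distr \<Omega> borel (\<lambda>\<omega>. (fst (f (H \<omega>)), R \<omega>))) borel (inv f)"
    by (simp add: distr_distr comp_def)
  also have "\<dots> = distr p_H borel (\<lambda>h. inv f (f h))"
    unfolding joint[symmetric] by (simp add: distr_distr comp_def)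
  also have "\<dots> = p_H"
    using invertible_nn_bij[OF assms(4)] assms(3) by (simp add: bij_is_inj distr_id2)
  \<comment> \<open>For equal measures the three terms cancel as
    \<open>a + a - 2 * a\<close>.\<close>
  finally show ?thesis by (simp add: MMD2_def)
qed

end
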